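(* Let $G=(V,A)$ be a heating network with supply graph $G^S=(V^S,A^S)$ and return graph $G^R=(V^R,A^R)$. For a supply arc $a^S\in A^S$, let $a^R\in A^R$ be the corresponding return arc, where we assume that they are oriented in opposite directions (if $a^S=(u^S,v^S)$ then $a^R=(v^R,u^R)$) and that $\zeta_{a^S}=\zeta_{a^R}$. Then for every feasible solution of the stationary heating network model, $\dot m_{a^S}=\dot m_{a^R}$ for every $a^S\in A^S$.
   Context: **Heating network.** A heating network is a weakly connected, simple directed graph $G=(V,A)$ (no self-loops, no parallel or antiparallel arcs) with $V=V^S\,\dot\cup\,V^R$ (supply and return nodes) and $A=A^S\,\dot\cup\,A^R\,\dot\cup\,A^H\,\dot\cup\,A^D$, where $A^S\subset V^S\times V^S$ (supply pipes), $A^R\subset V^R\times V^R$ (return pipes), $A^H\subset V^R\times V^S$ (heating arcs), $A^D\subset V^S\times V^R$ (demand arcs). Put $A^P=A^S\cup A^R$ (pipe arcs). For $v\in V$, $\delta^+(v)$ and $\delta^-(v)$ are the sets of arcs leaving and entering $v$. **Correspondence (standing assumption).** The supply and return parts have identical topology: each node $v^S\in V^S$ has a unique corresponding node $v^R\in V^R$ (a bijection), and each arc $a^S\in A^S$ has a unique corresponding arc $a^R\in A^R$ (a bijection), joining the corresponding end nodes and having the same pipe parameters. Each pair $v^S,v^R$ of corresponding nodes is connected by exactly one arc of $A^H\cup A^D$ (either a heating arc $(v^R,v^S)$ or a demand arc $(v^S,v^R)$), and there are no other heating or demand arcs. **Parameters.** For $a\in A^P$: $\zeta_a=\lambda_a\frac{\ell_a}{d_a^5}\frac{8}{\pi^2\rho}>0$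 (with positive friction coefficient $\lambda_a$, length $\ell_a$, diameter $d_a$, and water density $\rho$), heat loss coefficient $\mu_a$, maximal mass flow $\overline m_a$. Further: gravitational constant $g$, node heights $h_v$ ($v\in V$), specific heat capacity $c_p>0$, ambient temperature $\tau$, pump efficiencies $\eta_a\in[0,1]$, bounds $\overline T_a$ and $\underline{\dot Q}_a$ for $a\in A^H$, demands $\dot Q^D_a$ for $a\in A^D$, minimal pressure drop $\underline{\Delta p}>0$, fixed consumer outlet temperature $\underline T$, and a node $\bar v$ with fixed pressure $\overline p$. **Feasible solution.** A feasible solution of the stationary heating network model consists of real values $\dot m_a$ ($a\in A$; mass flow, positive along the arc direction), $p_v,T_v$ ($v\in V$), $T^-_a$ ($a\in A$), $T^+_a$ ($a\in A^P$), $P_a,\dot Q_a$ ($a\in A^H$), and $b^+_a,b^-_a\in\{0,1\}$ ($a\in A^P$), where $b^+_a=1$, $b^-_a=0$ for $a\in A^H\cup A^D$, satisfying: - $\sum_{a\in\delta^+(v)}\dot m_a-\sum_{a\in\delta^-(v)}\dot m_a=0$ for all $v\in V$; - temperature mixing, for all $v\in V$: $T_v\big(\sum_{a\in\delta^-(v)}b^+_a\dot m_a-\sum_{a\in\delta^+(v)}b^-_a\dot m_a\big)=\sum_{a\in\delta^-(v)}b^+_a\dot m_aT^-_a-\sum_{a\in\delta^+(v)}b^-_a\dot m_aT^-_a$; - $p_u-p_v=\zeta_a\dot m_a|\dot m_a|-\rho g(h_u-h_v)$ for $a=(u,v)\in A^P$; - $p_u-p_v\ge\underline{\Delta p}$ for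 $a=(u,v)\in A^D$; - $P_a=\frac{1}{\eta_a\rho}(p_v-p_u)\dot m_a$ and $\dot Q_a=c_p\dot m_a(T_u-T^-_a)$ for $a=(u,v)\in A^H$; - $|\dot m_a|T^-_a=|\dot m_a|T^+_a-\frac{\mu_a\ell_a}{c_p}(T^+_a-\tau)$ and $T^+_a=T_ub^+_a+T_vb^-_a$ for $a=(u,v)\in A^P$; - $c_p\dot m_a(T_u-\underline T)=\dot Q^D_a$ and $T^-_a=\underline T$ for $a=(u,v)\in A^D$; - $b^+_a+b^-_a=1$ and $-\overline m_ab^-_a\le\dot m_a\le\overline m_ab^+_a$ for $a\in A^P$; - $p_{\bar v}=\overline p$; $T_v\ge\tau$ for $v\in V$; $T^-_a\ge\tau$ for $a\in A^P$; - $T^-_a\le\overline T_a$, $P_a\ge0$, $\underline{\dot Q}_a\le\dot Q_a\le0$ for $a\in A^H$; $\dot m_a\ge0$ for $a\in A^D\cup A^H$. *)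

theory Defs
  imports Complex_Main "Graph_Theory.Digraph_Component"
begin

record 'v network =
  supply_nodes :: "'v set"
  return_nodes :: "'v set"
  supply_arcs :: "'v rel"
  return_arcs :: "'v rel"
  heating_arcs :: "'v rel"
  demand_arcs :: "'v rel"
  node_corr :: "'v \<Rightarrow> 'v"            (* v^S maps to v^R; only meaningful on V^S *)
  arc_corr :: "'v \<times> 'v \<Rightarrow> 'v \<times> 'v"   (* a^S maps to a^R; only meaningful on A^S *)
  friction :: "'v \<times> 'v \<Rightarrow> real"       (* lambda *)
  pipe_length :: "'v \<times> 'v \<Rightarrow> real"
  pipe_diameter :: "'v \<times> 'v \<Rightarrow> real"
  heat_loss :: "'v \<times> 'v \<Rightarrow> real"      (* mu *)
  max_flow :: "'v \<times> 'v \<Rightarrow> real"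
  water_density :: real               (* rho *)
  grav_const :: real
  node_height :: "'v \<Rightarrow> real"
  heat_capacity :: real               (* c_p *)
  ambient_temp :: real                (* tau *)
  pump_efficiency :: "'v \<times> 'v \<Rightarrow> real" (* eta *)
  max_heating_temp :: "'v \<times> 'v \<Rightarrow> real"
  min_heat :: "'v \<times> 'v \<Rightarrow> real"       (* lower bound on the (nonpositive) heat Q *)
  heat_demand :: "'v \<times> 'v \<Rightarrow> real"
  min_pressure_drop :: real
  consumer_outlet_temp :: real
  ref_node :: "'v"
  ref_pressure :: real

definition pipe_arcs :: "'v network \<Rightarrow> 'v rel" where
  "pipe_arcs N = supply_arcs N \<union> return_arcs N"

definition network_graph :: "'v network \<Rightarrow> 'v pair_pre_digraph" where
  "network_graph N =
     \<lparr> pverts = supply_nodes N \<union> return_nodes N,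
       parcs = supply_arcs N \<union> return_arcs N \<union> heating_arcs N \<union> demand_arcs N \<rparr>"

definition zeta :: "'v network \<Rightarrow> 'v \<times> 'v \<Rightarrow> real" where
  "zeta N a = friction N a * (pipe_length N a / pipe_diameter N a ^ 5)
                * (8 / (pi ^ 2 * water_density N))"

text \<open>
  Arcs are pairs of nodes, so parallel arcs cannot occur; \<^locale>\<open>pair_digraph\<close> provides finiteness
  and excludes self-loops. The four arc classes are pairwise disjoint because the two node
  classes are.  The constant \<^const>\<open>Digraph_Component.connected\<close> is weak connectivity.
\<close>

locale heating_network = pair_digraph "network_graph N" for N :: "'v network" +
  assumes weakly_connected: "Digraph_Component.connected (with_proj (network_graph N))"
    and no_antiparallel: "\<forall>(u, v) \<in> parcs (network_graph N). (v, u) \<notin> parcs (network_graph N)"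
    and nodes_disjoint: "supply_nodes N \<inter> return_nodes N = {}"
    and supply_arcs_sub: "supply_arcs N \<subseteq> supply_nodes N \<times> supply_nodes N"
    and return_arcs_sub: "return_arcs N \<subseteq> return_nodes N \<times> return_nodes N"
    and heating_arcs_sub: "heating_arcs N \<subseteq> return_nodes N \<times> supply_nodes N"
    and demand_arcs_sub: "demand_arcs N \<subseteq> supply_nodes N \<times> return_nodes N"
    \<comment> \<open>Correspondence; the orientation of a return arc relative to its supply arc is left open here.\<close>
    and node_corr_bij: "bij_betw (node_corr N) (supply_nodes N) (return_nodes N)"
    and arc_corr_bij: "bij_betw (arc_corr N) (supply_arcs N) (return_arcs N)"
    and arc_corr_ends: "\<forall>(u, v) \<in> supply_arcs N.
        arc_corr N (u, v) \<in> {(node_corr N u, node_corr N v), (node_corr N v, node_corr N u)}"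
    and arc_corr_params: "\<forall>a \<in> supply_arcs N.
        friction N (arc_corr N a) = friction N a \<and>
        pipe_length N (arc_corr N a) = pipe_length N a \<and>
        pipe_diameter N (arc_corr N a) = pipe_diameter N a \<and>
        heat_loss N (arc_corr N a) = heat_loss N a \<and>
        max_flow N (arc_corr N a) = max_flow N a"
    and one_vertical_arc: "\<forall>v \<in> supply_nodes N.
        ((node_corr N v, v) \<in> heating_arcs N) \<noteq> ((v, node_corr N v) \<in> demand_arcs N)"
    and no_other_heating: "\<forall>(u, v) \<in> heating_arcs N. u = node_corr N v"
    and no_other_demand: "\<forall>(u, v) \<in> demand_arcs N. v = node_corr N u"
    and pipe_params_pos: "\<forall>a \<in> pipe_arcs N.
        friction N a > 0 \<and> pipe_length N a > 0 \<and> pipe_diameter N a > 0"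
    and water_density_pos: "water_density N > 0"
    and heat_capacity_pos: "heat_capacity N > 0"
    and pump_efficiency_range: "\<forall>a \<in> heating_arcs N. pump_efficiency N a \<in> {0..1}"
    and min_pressure_drop_pos: "min_pressure_drop N > 0"
    and ref_node_in: "ref_node N \<in> pverts (network_graph N)"

lemma (in heating_network) zeta_pos: "a \<in> pipe_arcs N \<Longrightarrow> zeta N a > 0"
  using pipe_params_pos water_density_pos by (auto simp: zeta_def intro!: mult_pos_pos divide_pos_pos)

text \<open>
  Each field is a total function; the values outside the index set named below are irrelevant.
  In the pump power equation a zero efficiency makes the quotient 0, so it then reads \<open>P = 0\<close>.
\<close>

record 'v state =
  mass_flow :: "'v \<times> 'v \<Rightarrow> real"   (* A *)
  pressure :: "'v \<Rightarrow> real"         (* V *)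
  node_temp :: "'v \<Rightarrow> real"        (* V; T_v *)
  out_temp :: "'v \<times> 'v \<Rightarrow> real"    (* A; T^-_a *)
  in_temp :: "'v \<times> 'v \<Rightarrow> real"     (* A^P; T^+_a *)
  pump_power :: "'v \<times> 'v \<Rightarrow> real"  (* A^H; P_a *)
  heat_power :: "'v \<times> 'v \<Rightarrow> real"  (* A^H; Q_a *)
  bplus :: "'v \<times> 'v \<Rightarrow> real"       (* A *)
  bminus :: "'v \<times> 'v \<Rightarrow> real"      (* A *)

locale feasible_solution =
  fixes N :: "'v network" and s :: "'v state"
  assumes flow_conservation: "\<forall>v \<in> pverts (network_graph N).
        (\<Sum>a \<in> out_arcs (network_graph N) v. mass_flow s a)
          - (\<Sum>a \<in> in_arcs (network_graph N) v. mass_flow s a) = 0"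
    and temperature_mixing: "\<forall>v \<in> pverts (network_graph N).
        node_temp s v *
          ((\<Sum>a \<in> in_arcs (network_graph N) v. bplus s a * mass_flow s a)
            - (\<Sum>a \<in> out_arcs (network_graph N) v. bminus s a * mass_flow s a))
        = (\<Sum>a \<in> in_arcs (network_graph N) v. bplus s a * mass_flow s a * out_temp s a)
            - (\<Sum>a \<in> out_arcs (network_graph N) v. bminus s a * mass_flow s a * out_temp s a)"
    and pipe_pressure: "\<forall>(u, v) \<in> pipe_arcs N.
        pressure s u - pressure s v =
          zeta N (u, v) * mass_flow s (u, v) * \<bar>mass_flow s (u, v)\<bar>
            - water_density N * grav_const N * (node_height N u - node_height N v)"
    and demand_pressure: "\<forall>(u, v) \<in> demand_arcs N.
        pressure s u - pressure s v \<ge> min_pressure_drop N"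
    and pump_power_eq: "\<forall>(u, v) \<in> heating_arcs N.
        pump_power s (u, v) =
          1 / (pump_efficiency N (u, v) * water_density N)
            * (pressure s v - pressure s u) * mass_flow s (u, v)"
    and heat_power_eq: "\<forall>(u, v) \<in> heating_arcs N.
        heat_power s (u, v) =
          heat_capacity N * mass_flow s (u, v) * (node_temp s u - out_temp s (u, v))"
    and pipe_heat_loss: "\<forall>a \<in> pipe_arcs N.
        \<bar>mass_flow s a\<bar> * out_temp s a =
          \<bar>mass_flow s a\<bar> * in_temp s a
            - heat_loss N a * pipe_length N a / heat_capacity N * (in_temp s a - ambient_temp N)"
    and pipe_in_temp: "\<forall>(u, v) \<in> pipe_arcs N.
        in_temp s (u, v) = node_temp s u * bplus s (u, v) + node_temp s v * bminus s (u, v)"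
    and demand_heat: "\<forall>(u, v) \<in> demand_arcs N.
        heat_capacity N * mass_flow s (u, v) * (node_temp s u - consumer_outlet_temp N)
          = heat_demand N (u, v)"
    and demand_out_temp: "\<forall>a \<in> demand_arcs N. out_temp s a = consumer_outlet_temp N"
    and direction_binary: "\<forall>a \<in> pipe_arcs N. bplus s a \<in> {0, 1} \<and> bminus s a \<in> {0, 1}"
    and direction_fixed: "\<forall>a \<in> heating_arcs N \<union> demand_arcs N. bplus s a = 1 \<and> bminus s a = 0"
    and direction_sum: "\<forall>a \<in> pipe_arcs N. bplus s a + bminus s a = 1"
    and direction_flow: "\<forall>a \<in> pipe_arcs N.
        - (max_flow N a * bminus s a) \<le> mass_flow s a \<and>
        mass_flow s a \<le> max_flow N a * bplus s a"
    and fixed_pressure: "pressure s (ref_node N) = ref_pressure N"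
    and node_temp_bound: "\<forall>v \<in> pverts (network_graph N). node_temp s v \<ge> ambient_temp N"
    and pipe_out_temp_bound: "\<forall>a \<in> pipe_arcs N. out_temp s a \<ge> ambient_temp N"
    and heating_out_temp_bound: "\<forall>a \<in> heating_arcs N. out_temp s a \<le> max_heating_temp N a"
    and pump_power_nonneg: "\<forall>a \<in> heating_arcs N. pump_power s a \<ge> 0"
    and heat_power_bounds: "\<forall>a \<in> heating_arcs N. min_heat N a \<le> heat_power s a \<and> heat_power s a \<le> 0"
    and flow_nonneg: "\<forall>a \<in> demand_arcs N \<union> heating_arcs N. mass_flow s a \<ge> 0"

end

(* Under the reversed orientation, the difference d(a) = m(a^S) - m(a^R) is a circulation on the
   supply graph, because the heating and demand arcs contribute equally to the balances at v^S
   and v^R.  The sums over corresponding nodes of pressure plus hydrostatic head form a potential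
   whose drop along a^S is zeta (m(a^S) |m(a^S)| - m(a^R) |m(a^R)|).  A circulation is orthogonal
   to potential differences, so the nonnegative terms
   zeta (m(a^S) - m(a^R)) (m(a^S) |m(a^S)| - m(a^R) |m(a^R)|) sum to zero; since x |x| is strictly
   increasing, m(a^S) = m(a^R). *)
theory Submission
  imports Defs
begin

text \<open>Grouping the sum once by tails and once by heads gives each node \<open>v\<close> the
  factor \<open>\<pi> v\<close> times outflow minus inflow, which the balance makes zero.\<close>

lemma circulation_orthogonal_potential:
  fixes d :: "'v \<times> 'v \<Rightarrow> 'a :: comm_ring" and \<pi> :: "'v \<Rightarrow> 'a"
  assumes "finite A" "finite V" "A \<subseteq> V \<times> V"
    and balance: "\<And>v. v \<in> V \<Longrightarrow> sum d {a \<in> A. fst a = v} = sum d {a \<in> A. snd a = v}"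
  shows "(\<Sum>a \<in> A. d a * (\<pi> (fst a) - \<pi> (snd a))) = 0"
proof -
  have by_end: "(\<Sum>a \<in> A. d a * \<pi> (e a)) = (\<Sum>v \<in> V. sum d {a \<in> A. e a = v} * \<pi> v)"
    if "e ` A \<subseteq> V" for e
    unfolding sum.group[OF assms(1,2) that, symmetric]
    by (auto simp: sum_distrib_right intro!: sum.cong)
  have "fst ` A \<subseteq> V" "snd ` A \<subseteq> V"
    using assms(3) by auto
  then show ?thesis
    by (simp add: right_diff_distrib sum_subtractf by_end balance)
qed

lemma mult_abs_strict_mono:
  fixes x y :: "'a :: linordered_idom"
  assumes "x < y"
  shows "x * \<bar>x\<bar> < y * \<bar>y\<bar>"
proof (cases "0 \<le> x")
  case True
  with assms show ?thesis by (auto intro: mult_strict_mono)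
next
  case x: False
  show ?thesis
  proof (cases "0 \<le> y")
    case True
    have "x * \<bar>x\<bar> < 0" using x by (intro mult_neg_pos) auto
    also have "0 \<le> y * \<bar>y\<bar>" using True by simp
    finally show ?thesis .
  next
    case False
    have "(- y) * (- y) < (- x) * (- x)"
      using assms False by (intro mult_strict_mono) auto
    then show ?thesis using x False by simp
  qed
qed

text \<open>By strict monotonicity of \<open>x * \<bar>x\<bar>\<close> the two factors have the same
  sign.\<close>

lemma diff_mult_abs_diff_pos:
  fixes x y :: "'a :: linordered_idom"
  assumes "x \<noteq> y"
  shows "0 < (x - y) * (x * \<bar>x\<bar> - y * \<bar>y\<bar>)"
  using assms mult_abs_strict_mono[of x y] mult_abs_strict_mono[of y x]
  by (cases x y rule: linorder_cases) (auto intro: mult_pos_pos mult_neg_neg)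

context heating_network
begin

lemma finite_arc_classes:
  "finite (supply_arcs N)" "finite (return_arcs N)"
  "finite (heating_arcs N)" "finite (demand_arcs N)"
  using pair_finite_arcs by (auto simp: network_graph_def)

lemma finite_supply_nodes: "finite (supply_nodes N)"
  using pair_finite_verts by (auto simp: network_graph_def)

lemma supply_arc_nodes:
  "(u, v) \<in> supply_arcs N \<Longrightarrow> u \<in> supply_nodes N \<and> v \<in> supply_nodes N"
  using supply_arcs_sub by auto

lemma node_corr_return: "v \<in> supply_nodes N \<Longrightarrow> node_corr N v \<in> return_nodes N"
  using node_corr_bij by (auto simp: bij_betw_def)

lemma node_corr_eq_iff:
  "u \<in> supply_nodes N \<Longrightarrow> v \<in> supply_nodes N \<Longrightarrow> node_corr N u = node_corr N v \<longleftrightarrow> u = v"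
  using node_corr_bij by (auto simp: bij_betw_def inj_on_eq_iff)

lemma supply_node_arcs:
  assumes "v \<in> supply_nodes N"
  shows "out_arcs (network_graph N) v
           = {a \<in> supply_arcs N. fst a = v} \<union> {a \<in> demand_arcs N. fst a = v}"
    and "in_arcs (network_graph N) v
           = {a \<in> supply_arcs N. snd a = v} \<union> {a \<in> heating_arcs N. snd a = v}"
  using assms nodes_disjoint supply_arcs_sub return_arcs_sub heating_arcs_sub demand_arcs_sub
  by (auto simp: out_arcs_def in_arcs_def network_graph_def)

lemma return_node_arcs:
  assumes "v \<in> return_nodes N"
  shows "out_arcs (network_graph N) v
           = {a \<in> return_arcs N. fst a = v} \<union> {a \<in> heating_arcs N. fst a = v}"
    and "in_arcs (network_graph N) v
           = {a \<in> return_arcs N. snd a = v} \<union> {a \<in> demand_arcs N. snd a = v}"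
  using assms nodes_disjoint supply_arcs_sub return_arcs_sub heating_arcs_sub demand_arcs_sub
  by (auto simp: out_arcs_def in_arcs_def network_graph_def)

text \<open>A vertical arc joins a supply node to its own counterpart, and \<open>node_corr\<close>
  is injective there, so an arc at one of the two nodes is also an arc at the other.\<close>

lemma vertical_arcs_at_node_corr:
  assumes "v \<in> supply_nodes N"
  shows "{a \<in> heating_arcs N. fst a = node_corr N v} = {a \<in> heating_arcs N. snd a = v}"
    and "{a \<in> demand_arcs N. snd a = node_corr N v} = {a \<in> demand_arcs N. fst a = v}"
  using assms no_other_heating no_other_demand heating_arcs_sub demand_arcs_sub
  \<comment> \<open>The rotation makes the equation between images the major premise of the
    destruction rule.\<close>
  by (fastforce dest: node_corr_eq_iff[THEN iffD1, rotated 2])+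

lemma pipe_vertical_disjoint:
  "supply_arcs N \<inter> heating_arcs N = {}" "supply_arcs N \<inter> demand_arcs N = {}"
  "return_arcs N \<inter> heating_arcs N = {}" "return_arcs N \<inter> demand_arcs N = {}"
  using nodes_disjoint supply_arcs_sub return_arcs_sub heating_arcs_sub demand_arcs_sub by auto

context
  assumes opposite: "\<forall>(u, v) \<in> supply_arcs N. arc_corr N (u, v) = (node_corr N v, node_corr N u)"
begin

text \<open>Reindexing along the bijection \<open>arc_corr\<close>; the opposite orientation is what
  swaps tails and heads.\<close>

lemma return_arcs_at_node_corr:
  assumes v: "v \<in> supply_nodes N"
  shows "sum f {a \<in> return_arcs N. fst a = node_corr N v}
           = sum (f \<circ> arc_corr N) {a \<in> supply_arcs N. snd a = v}"
    and "sum f {a \<in> return_arcs N. snd a = node_corr N v}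
           = sum (f \<circ> arc_corr N) {a \<in> supply_arcs N. fst a = v}"
proof -
  have image: "return_arcs N = arc_corr N ` supply_arcs N" and inj: "inj_on (arc_corr N) (supply_arcs N)"
    using arc_corr_bij by (auto simp: bij_betw_def)
  have ends: "fst (arc_corr N a) = node_corr N v \<longleftrightarrow> snd a = v"
      "snd (arc_corr N a) = node_corr N v \<longleftrightarrow> fst a = v" if "a \<in> supply_arcs N" for a
    using opposite that v supply_arc_nodes by (cases a; fastforce simp: node_corr_eq_iff)+
  have "{a \<in> return_arcs N. fst a = node_corr N v} = arc_corr N ` {a \<in> supply_arcs N. snd a = v}"
    "{a \<in> return_arcs N. snd a = node_corr N v} = arc_corr N ` {a \<in> supply_arcs N. fst a = v}"
    unfolding image using ends by auto
  then show "sum f {a \<in> return_arcs N. fst a = node_corr N v}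
           = sum (f \<circ> arc_corr N) {a \<in> supply_arcs N. snd a = v}"
    "sum f {a \<in> return_arcs N. snd a = node_corr N v}
           = sum (f \<circ> arc_corr N) {a \<in> supply_arcs N. fst a = v}"
    by (simp_all add: sum.reindex inj_on_subset[OF inj])
qed

text \<open>If \<open>H\<close> enters \<open>v\<close> by heating arcs and \<open>D\<close> leaves
  it by demand arcs, the net outflow of \<open>m\<close> along supply arcs at \<open>v\<close> is
  \<open>H - D\<close>. At the counterpart \<open>H\<close> leaves and \<open>D\<close> enters;
  since return arcs are reversed, \<open>m \<circ> arc_corr\<close> has the same net outflow
  \<open>H - D\<close> at \<open>v\<close>.\<close>

lemma flow_difference_balance:
  assumes conservation: "\<forall>v \<in> pverts (network_graph N).
      (\<Sum>a \<in> out_arcs (network_graph N) v. m a) - (\<Sum>a \<in> in_arcs (network_graph N) v. m a) = 0"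
    and v: "v \<in> supply_nodes N"
  shows "(\<Sum>a \<in> {a \<in> supply_arcs N. fst a = v}. m a - m (arc_corr N a))
       = (\<Sum>a \<in> {a \<in> supply_arcs N. snd a = v}. m a - m (arc_corr N a) :: real)"
proof -
  have split: "sum m ({a \<in> A. P a} \<union> {a \<in> B. Q a}) = sum m {a \<in> A. P a} + sum m {a \<in> B. Q a}"
    if "finite A" "finite B" "A \<inter> B = {}" for A B P Q
    using that by (intro sum.union_disjoint) auto
  have v': "node_corr N v \<in> return_nodes N"
    using v by (rule node_corr_return)
  have "v \<in> pverts (network_graph N)" "node_corr N v \<in> pverts (network_graph N)"
    using v v' by (auto simp: network_graph_def)
  note this[THEN conservation[rule_format]]
  then show ?thesis
    by (simp add: supply_node_arcs[OF v] return_node_arcs[OF v'] split finite_arc_classes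
        pipe_vertical_disjoint vertical_arcs_at_node_corr[OF v] return_arcs_at_node_corr[OF v]
        sum_subtractf)
qed

end

end

theorem theorem6:
  fixes N :: "'v network" and s :: "'v state"
  assumes network: "heating_network N"
    and opposite: "\<forall>(u, v) \<in> supply_arcs N. arc_corr N (u, v) = (node_corr N v, node_corr N u)"
    and same_zeta: "\<forall>a \<in> supply_arcs N. zeta N a = zeta N (arc_corr N a)"
    and feasible: "feasible_solution N s"
  shows "\<forall>a \<in> supply_arcs N. mass_flow s a = mass_flow s (arc_corr N a)"
proof -
  interpret heating_network N by (rule network)
  interpret feasible_solution N s by (rule feasible)
  \<comment> \<open>Including the height term turns the pipe equation into a pure difference of node
    values.\<close>
  define head where
    "head v = pressure s v + water_density N * grav_const N * node_height N v" for v
  \<comment> \<open>A sum, not a difference, of heads: the return arc runs backwards, so its drop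
    enters the drop of \<open>\<pi>\<close> with a minus sign.\<close>
  define \<pi> where "\<pi> v = head v + head (node_corr N v)" for v
  define d where "d a = mass_flow s a - mass_flow s (arc_corr N a)" for a
  define q where "q a = mass_flow s a * \<bar>mass_flow s a\<bar>" for a
  have pipe: "head u - head v = zeta N (u, v) * q (u, v)" if "(u, v) \<in> pipe_arcs N" for u v
    using pipe_pressure that by (fastforce simp: head_def q_def algebra_simps)
  have drop: "\<pi> (fst a) - \<pi> (snd a) = zeta N a * (q a - q (arc_corr N a))"
    if a: "a \<in> supply_arcs N" for a
  proof -
    obtain u v where uv: "a = (u, v)" by fastforce
    have corr: "arc_corr N a = (node_corr N v, node_corr N u)"
      using opposite a uv by auto
    have "arc_corr N a \<in> return_arcs N"
      using arc_corr_bij a by (auto simp: bij_betw_def)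
    then have "head (node_corr N v) - head (node_corr N u) = zeta N a * q (arc_corr N a)"
      using pipe same_zeta a corr by (auto simp: pipe_arcs_def)
    moreover have "head u - head v = zeta N a * q a"
      using pipe a uv by (auto simp: pipe_arcs_def)
    ultimately show ?thesis
      by (simp add: uv \<pi>_def right_diff_distrib)
  qed
  \<comment> \<open>The summand of the orthogonality relation for \<open>d\<close> and
    \<open>\<pi>\<close>, rewritten by \<open>drop\<close> so that its sign is visible.\<close>
  define t where "t a = zeta N a * (d a * (q a - q (arc_corr N a)))" for a
  have pos: "0 < t a" if "a \<in> supply_arcs N" "d a \<noteq> 0" for a
    unfolding t_def d_def q_def using that
    by (intro mult_pos_pos[OF zeta_pos] diff_mult_abs_diff_pos) (auto simp: pipe_arcs_def d_def)
  have nonneg: "0 \<le> t a" if "a \<in> supply_arcs N" for a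
    using pos[OF that] by (cases "d a = 0") (auto simp: t_def)
  have "sum t (supply_arcs N) = (\<Sum>a \<in> supply_arcs N. d a * (\<pi> (fst a) - \<pi> (snd a)))"
    by (intro sum.cong) (simp_all add: t_def drop)
  also have "\<dots> = 0"
    using flow_difference_balance[OF opposite flow_conservation]
    by (intro circulation_orthogonal_potential[OF finite_arc_classes(1) finite_supply_nodes
          supply_arcs_sub]) (simp add: d_def)
  \<comment> \<open>Nonnegative terms with sum zero all vanish; by \<open>pos\<close> this leaves
    only \<open>d a = 0\<close>.\<close>
  finally have "\<forall>a \<in> supply_arcs N. t a = 0"
    using sum_nonneg_eq_0_iff[OF finite_arc_classes(1), of t] nonneg by blast
  then show ?thesis
    using pos by (fastforce simp: d_def)
qed

end
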